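(* Let $(G_n)_{n\in\mathbb{N}}$ be a first order convergent sequence of finite graphs, let $M$ be a modeling that is a limit of $(G_n)_{n\in\mathbb{N}}$, and let $m$ be a positive integer. Then for almost every $m$-tuple $(w_1,\dots,w_m)$ of vertices of $M$ (with respect to the product measure on $M^m$; i.e., the exceptional $m$-tuples are contained in a set of measure zero) the following holds: if $M'$ is the $m$-rooted modeling obtained from $M$ by rooting at $w_1,\dots,w_m$, then there exists a sequence $(v_{n,1},\dots,v_{n,m})_{n\in\mathbb{N}}$, where $v_{n,1},\dots,v_{n,m}$ are vertices of $G_n$, such that the $m$-rooted graphs $G'_n$ obtained from $G_n$ by rooting at $v_{n,1},\dots,v_{n,m}$ first order converge to $M'$, i.e., $\lim_n\langle\psi,G'_n\rangle=\langle\psi,M'\rangle$ for every first order formula $\psi$ for $m$-rooted graphs.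
   Context: Graphs are structures in the first order language with one binary (adjacency) relation; an $m$-rooted graph/modeling is a structure in the language extended by $m$ constants $c_1,\dots,c_m$, and rooting at $v_1,\dots,v_m$ means interpreting $c_i$ as $v_i$. A modeling is a (finite or infinite) graph (or $m$-rooted graph) whose vertex set carries a probability measure such that for every first order formula $\psi$ with $k$ free variables the set of $k$-tuples satisfying $\psi$ is measurable in the product measure. The Stone pairing $\langle\psi,M\rangle$ is the measure of the set of $k$-tuples satisfying $\psi$ (for a sentence: $1$ if satisfied, $0$ otherwise). A finite graph is a modeling with the uniform measure on its vertices. A sequence $(G_n)$ is first order convergent if $\lim_n\langle\psi,G_n\rangle$ exists for every first order formula $\psi$, and a modeling $M$ is its limit if $\lim_n\langle\psi,G_n\rangle=\langle\psi,M\rangle$ for every first order formula $\psi$. *)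

theory Defs
  imports "HOL-Probability.Probability"
begin

datatype tm = Var nat | Cst nat

datatype fm =
    Equal tm tm
  | Adj tm tm
  | Neg fm
  | Conj fm fm
  | Ex nat fm

fun fv_tm :: "tm \<Rightarrow> nat set" where
  "fv_tm (Var x) = {x}"
| "fv_tm (Cst i) = {}"

fun fv :: "fm \<Rightarrow> nat set" where
  "fv (Equal s t) = fv_tm s \<union> fv_tm t"
| "fv (Adj s t) = fv_tm s \<union> fv_tm t"
| "fv (Neg \<phi>) = fv \<phi>"
| "fv (Conj \<phi> \<psi>) = fv \<phi> \<union> fv \<psi>"
| "fv (Ex x \<phi>) = fv \<phi> - {x}"

fun csts_tm :: "tm \<Rightarrow> nat set" where
  "csts_tm (Var x) = {}"
| "csts_tm (Cst i) = {i}"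

fun csts :: "fm \<Rightarrow> nat set" where
  "csts (Equal s t) = csts_tm s \<union> csts_tm t"
| "csts (Adj s t) = csts_tm s \<union> csts_tm t"
| "csts (Neg \<phi>) = csts \<phi>"
| "csts (Conj \<phi> \<psi>) = csts \<phi> \<union> csts \<psi>"
| "csts (Ex x \<phi>) = csts \<phi>"

text \<open>The formulas for \<open>m\<close>-rooted graphs; the constants are indexed from \<open>0\<close>, so
  \<open>formulas 0\<close> is the plain language of graphs.\<close>

definition formulas :: "nat \<Rightarrow> fm set" where
  "formulas m = {\<phi>. csts \<phi> \<subseteq> {..<m}}"

text \<open>The vertex set is the space of the measure; only the restriction of \<open>adj\<close> to it matters.
  The constant \<open>Cst i\<close> is interpreted as \<open>roots G ! i\<close>; unrooted graphs have
  the empty list of roots.\<close>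

record 'a mgraph =
  vmeas :: "'a measure"
  adj :: "'a \<Rightarrow> 'a \<Rightarrow> bool"
  roots :: "'a list"

abbreviation verts :: "'a mgraph \<Rightarrow> 'a set" where
  "verts G \<equiv> space (vmeas G)"

fun val :: "'a mgraph \<Rightarrow> (nat \<Rightarrow> 'a) \<Rightarrow> tm \<Rightarrow> 'a" where
  "val G a (Var x) = a x"
| "val G a (Cst i) = roots G ! i"

fun sat :: "'a mgraph \<Rightarrow> (nat \<Rightarrow> 'a) \<Rightarrow> fm \<Rightarrow> bool" where
  "sat G a (Equal s t) \<longleftrightarrow> val G a s = val G a t"
| "sat G a (Adj s t) \<longleftrightarrow> adj G (val G a s) (val G a t)"
| "sat G a (Neg \<phi>) \<longleftrightarrow> \<not> sat G a \<phi>"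
| "sat G a (Conj \<phi> \<psi>) \<longleftrightarrow> sat G a \<phi> \<and> sat G a \<psi>"
| "sat G a (Ex x \<phi>) \<longleftrightarrow> (\<exists>u\<in>verts G. sat G (a(x := u)) \<phi>)"

text \<open>For a formula with \<open>k\<close> free variables, the \<open>k\<close>-tuples of vertices are indexed by the
  set of its free variables. For a sentence this index set is empty, and the product measure
  is the probability measure on a one-point space.\<close>

definition tuples :: "'a mgraph \<Rightarrow> fm \<Rightarrow> (nat \<Rightarrow> 'a) measure" where
  "tuples G \<phi> = PiM (fv \<phi>) (\<lambda>_. vmeas G)"

definition sat_set :: "'a mgraph \<Rightarrow> fm \<Rightarrow> (nat \<Rightarrow> 'a) set" where
  "sat_set G \<phi> = {a \<in> space (tuples G \<phi>). sat G a \<phi>}"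

definition stone :: "fm \<Rightarrow> 'a mgraph \<Rightarrow> real" where
  "stone \<phi> G = measure (tuples G \<phi>) (sat_set G \<phi>)"

definition simple_graph :: "'a mgraph \<Rightarrow> bool" where
  "simple_graph G \<longleftrightarrow>
     (\<forall>x\<in>verts G. \<not> adj G x x) \<and>
     (\<forall>x\<in>verts G. \<forall>y\<in>verts G. adj G x y \<longrightarrow> adj G y x)"

definition modeling :: "nat \<Rightarrow> 'a mgraph \<Rightarrow> bool" where
  "modeling m G \<longleftrightarrow>
     simple_graph G \<and> length (roots G) = m \<and> set (roots G) \<subseteq> verts G \<and>
     prob_space (vmeas G) \<and>
     (\<forall>\<phi>\<in>formulas m. sat_set G \<phi> \<in> sets (tuples G \<phi>))"

definition finite_graph :: "'a mgraph \<Rightarrow> bool" where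
  "finite_graph G \<longleftrightarrow>
     simple_graph G \<and> roots G = [] \<and> finite (verts G) \<and> verts G \<noteq> {} \<and>
     vmeas G = uniform_count_measure (verts G)"

definition root_at :: "'a mgraph \<Rightarrow> 'a list \<Rightarrow> 'a mgraph" where
  "root_at G vs = G\<lparr>roots := vs\<rparr>"

definition fo_convergent :: "nat \<Rightarrow> (nat \<Rightarrow> 'a mgraph) \<Rightarrow> bool" where
  "fo_convergent m G \<longleftrightarrow> (\<forall>\<phi>\<in>formulas m. convergent (\<lambda>n. stone \<phi> (G n)))"

definition fo_limit :: "nat \<Rightarrow> (nat \<Rightarrow> 'a mgraph) \<Rightarrow> 'b mgraph \<Rightarrow> bool" where
  "fo_limit m G M \<longleftrightarrow> (\<forall>\<phi>\<in>formulas m. (\<lambda>n. stone \<phi> (G n)) \<longlonglongrightarrow> stone \<phi> M)"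

lemma finite_fv: "finite (fv \<phi>)"
proof (induction \<phi>)
  case (Equal s t) then show ?case by (cases s; cases t) auto
next
  case (Adj s t) then show ?case by (cases s; cases t) auto
qed auto

lemma stone_sentence:
  assumes "fv \<phi> = {}"
  shows "stone \<phi> G = (if sat G (\<lambda>_. undefined) \<phi> then 1 else 0)"
proof -
  have "sat_set G \<phi> = (if sat G (\<lambda>_. undefined) \<phi> then {\<lambda>_. undefined} else {})"
    using assms by (auto simp: sat_set_def tuples_def space_PiM)
  then show ?thesis
    using assms by (simp add: stone_def tuples_def PiM_empty measure_def)
qed

lemma modeling_finite_graph:
  assumes "finite_graph G"
  shows "modeling 0 G"
proof -
  have fin: "finite (verts G)" "verts G \<noteq> {}"
    and unif: "vmeas G = uniform_count_measure (verts G)"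
    using assms by (auto simp: finite_graph_def)
  have cs: "sets (vmeas G) = sets (count_space (verts G))"
    by (subst unif) (simp add: sets_uniform_count_measure)
  have "sat_set G \<phi> \<in> sets (tuples G \<phi>)" for \<phi>
  proof -
    have "sets (tuples G \<phi>) = sets (PiM (fv \<phi>) (\<lambda>_. count_space (verts G)))"
      unfolding tuples_def by (rule sets_PiM_cong) (auto simp: cs)
    also have "\<dots> = Pow (PiE (fv \<phi>) (\<lambda>_. verts G))"
      by (simp add: count_space_PiM_finite finite_fv fin countable_finite)
    finally show ?thesis
      by (auto simp: sat_set_def tuples_def space_PiM)
  qed
  moreover have "prob_space (vmeas G)"
    by (subst unif) (rule prob_space_uniform_count_measure[OF fin])
  ultimately show ?thesis
    using assms by (auto simp: modeling_def finite_graph_def)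
qed

end

theory Submission
  imports Defs
begin

text \<open>Replacing constants by fresh variables, Fubini turns the Stone pairing of an \<open>m\<close>-rooted
  formula into a function of the roots whose integral is the Stone pairing of an unrooted formula;
  products of such functions come from conjunctions of formulas with variables renamed apart.
  Hence all joint moments of the rooted Stone pairings converge along \<open>G\<close>. For almost every \<open>w\<close>,
  every ball with rational centre and radius containing the vector of pairings at \<open>w\<close>
  has positive measure. If \<open>X = c - (squared distance to the centre)\<close> then comparing high moments of \<open>X\<close> shows that
  \<open>G n\<close> eventually contains roots whose first \<open>K\<close> pairings are close to those at \<open>w\<close>, and a
  diagonal choice over \<open>K\<close> gives the sequence.\<close>

section \<open>Countability of formulas, renaming of variables and replacement of constants\<close>

instance tm :: countable by countable_datatype
instance fm :: countable by countable_datatype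

text \<open>The map \<open>r\<close> acts on bound variables too. Capture is then excluded once and
  for all when the terms \<open>s i\<close> use no variable in the range of
  \<open>r\<close>.\<close>

fun relabel_tm :: "(nat \<Rightarrow> nat) \<Rightarrow> (nat \<Rightarrow> tm) \<Rightarrow> tm \<Rightarrow> tm" where
  "relabel_tm r s (Var x) = Var (r x)"
| "relabel_tm r s (Cst i) = s i"

fun relabel :: "(nat \<Rightarrow> nat) \<Rightarrow> (nat \<Rightarrow> tm) \<Rightarrow> fm \<Rightarrow> fm" where
  "relabel r s (Equal t u) = Equal (relabel_tm r s t) (relabel_tm r s u)"
| "relabel r s (Adj t u) = Adj (relabel_tm r s t) (relabel_tm r s u)"
| "relabel r s (Neg \<phi>) = Neg (relabel r s \<phi>)"
| "relabel r s (Conj \<phi> \<psi>) = Conj (relabel r s \<phi>) (relabel r s \<psi>)"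
| "relabel r s (Ex x \<phi>) = Ex (r x) (relabel r s \<phi>)"

lemma val_cong: "(\<And>x. x \<in> fv_tm t \<Longrightarrow> a x = b x) \<Longrightarrow> val G a t = val G b t"
  by (cases t) auto

lemma sat_cong: "(\<And>x. x \<in> fv \<phi> \<Longrightarrow> a x = b x) \<Longrightarrow> sat G a \<phi> = sat G b \<phi>"
proof (induction \<phi> arbitrary: a b)
  case (Equal s t) then show ?case using val_cong[of s a b G] val_cong[of t a b G] by auto
next
  case (Adj s t) then show ?case using val_cong[of s a b G] val_cong[of t a b G] by auto
next
  case (Neg \<phi>) then show ?case by (metis fv.simps(3) sat.simps(3))
next
  case (Conj \<phi> \<psi>) then show ?case by (metis UnCI fv.simps(4) sat.simps(4))
next
  case (Ex x \<phi>)
  have "sat G (a(x := u)) \<phi> = sat G (b(x := u)) \<phi>" for u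
    by (rule Ex.IH) (use Ex.prems in auto)
  then show ?case by simp
qed

text \<open>Injectivity of \<open>r\<close> turns an update at \<open>r x\<close> into an update at
  \<open>x\<close>, and a quantifier over \<open>r x\<close> cannot change the value of
  \<open>s i\<close>. Letting \<open>H'\<close> carry other roots than \<open>H\<close> covers both
  the elimination of constants and a mere renaming.\<close>

lemma sat_relabel:
  assumes "inj r" "verts H' = verts H" "adj H' = adj H"
    and "\<And>i. i \<in> csts \<phi> \<Longrightarrow> fv_tm (s i) \<inter> range r = {}"
    and "\<And>i. i \<in> csts \<phi> \<Longrightarrow> val H b (s i) = roots H' ! i"
  shows "sat H b (relabel r s \<phi>) \<longleftrightarrow> sat H' (b \<circ> r) \<phi>"
  using assms(4,5)
proof (induction \<phi> arbitrary: b)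
  case (Equal t u)
  have "val H b (relabel_tm r s t) = val H' (b \<circ> r) t" "val H b (relabel_tm r s u) = val H' (b \<circ> r) u"
    using Equal.prems by (cases t; cases u; auto)+
  then show ?case by (simp only: relabel.simps sat.simps)
next
  case (Adj t u)
  have "val H b (relabel_tm r s t) = val H' (b \<circ> r) t" "val H b (relabel_tm r s u) = val H' (b \<circ> r) u"
    using Adj.prems by (cases t; cases u; auto)+
  then show ?case using assms(3) by (simp only: relabel.simps sat.simps)
next
  case (Ex x \<phi>)
  have "sat H (b(r x := u)) (relabel r s \<phi>) = sat H' ((b \<circ> r)(x := u)) \<phi>" for u
  proof -
    have "(b \<circ> r)(x := u) = b(r x := u) \<circ> r"
      using assms(1) by (auto simp: fun_eq_iff inj_eq)
    moreover have "sat H (b(r x := u)) (relabel r s \<phi>) = sat H' (b(r x := u) \<circ> r) \<phi>"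
    proof (rule Ex.IH)
      fix i assume i: "i \<in> csts \<phi>"
      then show "fv_tm (s i) \<inter> range r = {}" using Ex.prems(1) by simp
      then have "val H (b(r x := u)) (s i) = val H b (s i)" by (intro val_cong) auto
      then show "val H (b(r x := u)) (s i) = roots H' ! i" using Ex.prems(2) i by simp
    qed
    ultimately show ?thesis by simp
  qed
  then show ?case using assms(2) by (simp only: relabel.simps sat.simps)
qed auto

lemma fv_relabel:
  assumes "inj r" "\<And>i. i \<in> csts \<phi> \<Longrightarrow> fv_tm (s i) \<inter> range r = {}"
  shows "fv (relabel r s \<phi>) = r ` fv \<phi> \<union> (\<Union>i\<in>csts \<phi>. fv_tm (s i))"
  using assms(2)
proof (induction \<phi>)
  case (Equal t u) then show ?case by (cases t; cases u) auto
next
  case (Adj t u) then show ?case by (cases t; cases u) auto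
next
  case (Ex x \<phi>)
  then have "fv (relabel r s (Ex x \<phi>)) = r ` fv \<phi> - {r x} \<union> (\<Union>i\<in>csts \<phi>. fv_tm (s i))"
    by fastforce
  also have "r ` fv \<phi> - {r x} = r ` (fv \<phi> - {x})"
    using assms(1) by (auto simp: inj_eq)
  finally show ?case by simp
qed auto

lemma csts_relabel: "csts (relabel r s \<phi>) = (\<Union>i\<in>csts \<phi>. csts_tm (s i))"
proof (induction \<phi>)
  case (Equal t u) then show ?case by (cases t; cases u) auto
next
  case (Adj t u) then show ?case by (cases t; cases u) auto
qed auto


section \<open>Marginals and sections of product measures\<close>

lemma space_PiM_restrict_comp:
  assumes "b \<in> space (PiM J (\<lambda>_. N))" "r ` I \<subseteq> J"
  shows "(\<lambda>x\<in>I. b (r x)) \<in> space (PiM I (\<lambda>_. N))"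
  using assms by (fastforce simp: space_PiM)

text \<open>The restriction of the product over \<open>J\<close> to the coordinates
  \<open>r x\<close> has the law of \<open>tuples G \<phi>\<close>; the other coordinates carry
  probability measures and integrate out. This allows Stone pairings to be computed over any larger
  index set.\<close>

lemma sat_set_reindex:
  assumes "prob_space (vmeas G)" "sat_set G \<phi> \<in> sets (tuples G \<phi>)"
    and "inj_on r (fv \<phi>)" "r ` fv \<phi> \<subseteq> J"
  shows "{b \<in> space (PiM J (\<lambda>_. vmeas G)). sat G (b \<circ> r) \<phi>} \<in> sets (PiM J (\<lambda>_. vmeas G))" (is ?sets)
    and "measure (PiM J (\<lambda>_. vmeas G)) {b \<in> space (PiM J (\<lambda>_. vmeas G)). sat G (b \<circ> r) \<phi>} = stone \<phi> G"
      (is ?measure)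
proof -
  let ?J = "PiM J (\<lambda>_. vmeas G)"
  let ?t = "\<lambda>b. \<lambda>x\<in>fv \<phi>. b (r x)"
  have t: "?t \<in> measurable ?J (tuples G \<phi>)"
    unfolding tuples_def using assms(4) by (intro measurable_restrict measurable_component_singleton) auto
  have "sat G (?t b) \<phi> = sat G (b \<circ> r) \<phi>" for b
    by (rule sat_cong) simp
  then have eq: "{b \<in> space ?J. sat G (b \<circ> r) \<phi>} = ?t -` sat_set G \<phi> \<inter> space ?J"
    using space_PiM_restrict_comp[OF _ assms(4), of _ "vmeas G"] by (auto simp: sat_set_def tuples_def)
  show ?sets
    unfolding eq by (rule measurable_sets[OF t assms(2)])
  have "tuples G \<phi> = distr ?J (tuples G \<phi>) ?t"
    using distr_PiM_reindex[of J "\<lambda>_. vmeas G" r "fv \<phi>"] assms by (simp add: tuples_def image_subset_iff)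
  then show ?measure
    unfolding eq stone_def using measure_distr[OF t assms(2)] by simp
qed

text \<open>Tonelli's theorem after \<open>merge\<close> identifies the product over
  \<open>I \<union> J\<close> with the product of the two blocks. All section measures are at most
  1, so the nonnegative integral is also a Bochner integral.\<close>

lemma PiM_Un_section:
  assumes "prob_space N" "finite I" "finite J" "I \<inter> J = {}"
    and "{a \<in> space (PiM (I \<union> J) (\<lambda>_. N)). P a} \<in> sets (PiM (I \<union> J) (\<lambda>_. N))"
  shows "x \<in> space (PiM I (\<lambda>_. N)) \<Longrightarrow>
      {y \<in> space (PiM J (\<lambda>_. N)). P (merge I J (x, y))} \<in> sets (PiM J (\<lambda>_. N))"
    and "(\<lambda>x. measure (PiM J (\<lambda>_. N)) {y \<in> space (PiM J (\<lambda>_. N)). P (merge I J (x, y))})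
      \<in> borel_measurable (PiM I (\<lambda>_. N))"
    and "measure (PiM (I \<union> J) (\<lambda>_. N)) {a \<in> space (PiM (I \<union> J) (\<lambda>_. N)). P a} =
      (\<integral>x. measure (PiM J (\<lambda>_. N)) {y \<in> space (PiM J (\<lambda>_. N)). P (merge I J (x, y))} \<partial>PiM I (\<lambda>_. N))"
proof -
  let ?I = "PiM I (\<lambda>_. N)" and ?J = "PiM J (\<lambda>_. N)" and ?IJ = "PiM (I \<union> J) (\<lambda>_. N)"
  interpret N: prob_space N by fact
  have PS: "product_sigma_finite (\<lambda>_. N)"
    by unfold_locales
  interpret I: prob_space ?I by (intro prob_space_PiM assms)
  interpret J: prob_space ?J by (intro prob_space_PiM assms)
  let ?A = "{a \<in> space ?IJ. P a}"
  let ?Q = "merge I J -` ?A \<inter> space (?I \<Otimes>\<^sub>M ?J)"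
  have Q: "?Q \<in> sets (?I \<Otimes>\<^sub>M ?J)"
    by (rule measurable_sets[OF measurable_merge assms(5)])
  have sec: "Pair x -` ?Q = {y \<in> space ?J. P (merge I J (x, y))}" if "x \<in> space ?I" for x
    using measurable_space[OF measurable_merge, of _ I "\<lambda>_. N" J] that
    by (auto simp: space_pair_measure)
  show "{y \<in> space ?J. P (merge I J (x, y))} \<in> sets ?J" if "x \<in> space ?I" for x
    using sets_Pair1[OF Q, of x] sec[OF that] by simp
  have meas: "(\<lambda>x. measure ?J (Pair x -` ?Q)) \<in> borel_measurable ?I"
    unfolding measure_def using J.measurable_emeasure_Pair[OF Q] by measurable
  then show "(\<lambda>x. measure ?J {y \<in> space ?J. P (merge I J (x, y))}) \<in> borel_measurable ?I"
    by (subst measurable_cong[where g = "\<lambda>x. measure ?J (Pair x -` ?Q)"]) (auto simp only: sec)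
  have "emeasure ?IJ ?A = emeasure (distr (?I \<Otimes>\<^sub>M ?J) ?IJ (merge I J)) ?A"
    using product_sigma_finite.distr_merge[OF PS assms(4,2,3)] by simp
  also have "\<dots> = emeasure (?I \<Otimes>\<^sub>M ?J) ?Q"
    by (rule emeasure_distr[OF measurable_merge assms(5)])
  also have "\<dots> = (\<integral>\<^sup>+x. emeasure ?J (Pair x -` ?Q) \<partial>?I)"
    by (rule J.emeasure_pair_measure_alt[OF Q])
  also have "\<dots> = (\<integral>\<^sup>+x. ennreal (measure ?J (Pair x -` ?Q)) \<partial>?I)"
    by (simp add: J.emeasure_eq_measure)
  also have "\<dots> = ennreal (\<integral>x. measure ?J (Pair x -` ?Q) \<partial>?I)"
    by (intro nn_integral_eq_integral I.integrable_const_bound[where B = 1] meas) auto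
  finally have "measure ?IJ ?A = (\<integral>x. measure ?J (Pair x -` ?Q) \<partial>?I)"
    by (simp add: measure_def)
  also have "\<dots> = (\<integral>x. measure ?J {y \<in> space ?J. P (merge I J (x, y))} \<partial>?I)"
    by (intro Bochner_Integration.integral_cong) (auto simp only: sec)
  finally show "measure ?IJ ?A = (\<integral>x. measure ?J {y \<in> space ?J. P (merge I J (x, y))} \<partial>?I)" .
qed

section \<open>Products of Stone pairings\<close>

text \<open>Renaming the variables apart makes the two conjuncts independent, so Stone pairings multiply.\<close>

definition dconj :: "fm \<Rightarrow> fm \<Rightarrow> fm" where
  "dconj \<phi> \<psi> = Conj (relabel (\<lambda>x. 2 * x) Cst \<phi>) (relabel (\<lambda>x. Suc (2 * x)) Cst \<psi>)"

lemma dconj_formulas: "\<phi> \<in> formulas m \<Longrightarrow> \<psi> \<in> formulas m \<Longrightarrow> dconj \<phi> \<psi> \<in> formulas m"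
  by (auto simp: dconj_def formulas_def csts_relabel)

lemma fv_relabel_Cst: "inj r \<Longrightarrow> fv (relabel r Cst \<phi>) = r ` fv \<phi>"
  by (subst fv_relabel) auto

lemma sat_relabel_Cst: "inj r \<Longrightarrow> sat G b (relabel r Cst \<phi>) = sat G (b \<circ> r) \<phi>"
  by (rule sat_relabel) auto

lemma stone_dconj:
  assumes "modeling m G" "\<phi> \<in> formulas m" "\<psi> \<in> formulas m"
  shows "stone (dconj \<phi> \<psi>) G = stone \<phi> G * stone \<psi> G"
proof -
  let ?p = "\<lambda>x::nat. 2 * x" and ?q = "\<lambda>x::nat. Suc (2 * x)"
  let ?I = "?p ` fv \<phi>" and ?J = "?q ` fv \<psi>"
  let ?M = "\<lambda>I. PiM I (\<lambda>_. vmeas G)"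
  let ?A = "{a \<in> space (?M (?I \<union> ?J)). sat G a (dconj \<phi> \<psi>)}"
  have inj: "inj ?p" "inj ?q" by (auto simp: inj_def)
  have fv: "fv (dconj \<phi> \<psi>) = ?I \<union> ?J"
    by (simp add: dconj_def fv_relabel_Cst inj)
  have prob: "prob_space (vmeas G)" and ss: "\<And>\<theta>. \<theta> \<in> formulas m \<Longrightarrow> sat_set G \<theta> \<in> sets (tuples G \<theta>)"
    using assms(1) by (auto simp: modeling_def)
  have disj: "?I \<inter> ?J = {}" by (auto; presburger)
  have sat: "sat G (merge ?I ?J (x, y)) (dconj \<phi> \<psi>) \<longleftrightarrow> sat G (x \<circ> ?p) \<phi> \<and> sat G (y \<circ> ?q) \<psi>" for x y
  proof -
    have "sat G (merge ?I ?J (x, y) \<circ> ?p) \<phi> = sat G (x \<circ> ?p) \<phi>"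
      by (rule sat_cong) (simp add: merge_def)
    moreover have "sat G (merge ?I ?J (x, y) \<circ> ?q) \<psi> = sat G (y \<circ> ?q) \<psi>"
      using disj by (intro sat_cong) (auto simp add: merge_def)
    ultimately show ?thesis by (simp only: dconj_def sat.simps sat_relabel_Cst inj)
  qed
  interpret J: prob_space "?M ?J" by (intro prob_space_PiM prob)
  have A: "?A \<in> sets (?M (?I \<union> ?J))"
    using ss[OF dconj_formulas[OF assms(2,3)]] by (simp add: sat_set_def tuples_def fv)
  have "stone (dconj \<phi> \<psi>) G = measure (?M (?I \<union> ?J)) ?A"
    by (simp add: stone_def tuples_def fv sat_set_def)
  also have "\<dots> = (\<integral>x. measure (?M ?J) {y \<in> space (?M ?J). sat G (merge ?I ?J (x, y)) (dconj \<phi> \<psi>)} \<partial>?M ?I)"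
    using disj A by (intro PiM_Un_section(3) prob) (auto simp: finite_fv)
  \<comment> \<open>For fixed \<open>x\<close> the section is empty or consists of all
    \<open>y\<close> satisfying the second conjunct, whose measure is independent of
    \<open>x\<close>.\<close>
  also have "\<dots> = (\<integral>x. indicator {x \<in> space (?M ?I). sat G (x \<circ> ?p) \<phi>} x * stone \<psi> G \<partial>?M ?I)"
  proof (rule Bochner_Integration.integral_cong[OF refl])
    fix x assume "x \<in> space (?M ?I)"
    then show "measure (?M ?J) {y \<in> space (?M ?J). sat G (merge ?I ?J (x, y)) (dconj \<phi> \<psi>)} =
      indicator {x \<in> space (?M ?I). sat G (x \<circ> ?p) \<phi>} x * stone \<psi> G"
      unfolding sat
      using sat_set_reindex(2)[OF prob ss[OF assms(3)], of ?q ?J] inj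
      by (auto simp: indicator_def inj_on_def)
  qed
  also have "\<dots> = measure (?M ?I) {x \<in> space (?M ?I). sat G (x \<circ> ?p) \<phi>} * stone \<psi> G"
    by (subst Bochner_Integration.integral_mult_left_zero, subst Bochner_Integration.integral_indicator)
      (intro arg_cong2[where f = "(*)"] arg_cong[where f = "measure _"] refl, blast)
  also have "measure (?M ?I) {x \<in> space (?M ?I). sat G (x \<circ> ?p) \<phi>} = stone \<phi> G"
    by (rule sat_set_reindex(2)[OF prob ss[OF assms(2)]]) (auto simp: inj_on_def)
  finally show ?thesis .
qed

section \<open>Roots as free variables\<close>

text \<open>Shifting all variables, bound ones included, frees the names below \<open>m\<close> for the constants.\<close>

definition unroot :: "nat \<Rightarrow> fm \<Rightarrow> fm" where
  "unroot m \<phi> = relabel (\<lambda>x. x + m) Var \<phi>"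

lemma unroot_formulas: "unroot m \<phi> \<in> formulas k"
  by (simp add: unroot_def formulas_def csts_relabel)

lemma fv_unroot:
  assumes "\<phi> \<in> formulas m"
  shows "fv (unroot m \<phi>) = (\<lambda>x. x + m) ` fv \<phi> \<union> csts \<phi>"
  using assms unfolding unroot_def by (subst fv_relabel) (auto simp: formulas_def inj_def)

lemma root_at_simps [simp]:
  "vmeas (root_at G vs) = vmeas G" "adj (root_at G vs) = adj G" "roots (root_at G vs) = vs"
  by (simp_all add: root_at_def)

lemma sat_unroot:
  assumes "\<phi> \<in> formulas m"
  shows "sat G b (unroot m \<phi>) = sat (root_at G (map b [0..<m])) (\<lambda>x. b (x + m)) \<phi>"
  unfolding unroot_def
  by (subst sat_relabel[where H' = "root_at G (map b [0..<m])"])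
    (use assms in \<open>auto simp: formulas_def inj_def comp_def\<close>)

lemma sat_roots_cong:
  assumes "\<phi> \<in> formulas m" "\<And>i. i < m \<Longrightarrow> vs ! i = ws ! i"
  shows "sat (root_at G vs) a \<phi> = sat (root_at G ws) a \<phi>"
proof -
  \<comment> \<open>The identity relabelling is used because \<open>sat_relabel\<close> compares two
    structures whose roots agree only on the constants that occur.\<close>
  have "sat (root_at G vs) a (relabel id Cst \<phi>) = sat (root_at G ws) (a \<circ> id) \<phi>"
    by (rule sat_relabel) (use assms in \<open>auto simp: formulas_def\<close>)
  then show ?thesis by (simp add: sat_relabel_Cst)
qed

text \<open>Fixing the variables below \<open>m\<close> of \<open>unroot m \<phi>\<close> at
  \<open>w\<close> yields the solution set of \<open>\<phi>\<close> in the rooted graph, up to a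
  shift of the indices. Measurability and the integral formula are therefore statements about
  sections.\<close>

lemma rooted_stone:
  assumes "modeling 0 M" "\<phi> \<in> formulas m"
  shows "w \<in> space (PiM {..<m} (\<lambda>_. vmeas M)) \<Longrightarrow>
      sat_set (root_at M (map w [0..<m])) \<phi> \<in> sets (tuples (root_at M (map w [0..<m])) \<phi>)" (is "_ \<Longrightarrow> ?sets w")
    and "(\<lambda>w. stone \<phi> (root_at M (map w [0..<m]))) \<in> borel_measurable (PiM {..<m} (\<lambda>_. vmeas M))" (is ?meas)
    and "stone (unroot m \<phi>) M = (\<integral>w. stone \<phi> (root_at M (map w [0..<m])) \<partial>PiM {..<m} (\<lambda>_. vmeas M))" (is ?int)
proof -
  let ?r = "\<lambda>x::nat. x + m" and ?I = "{..<m}" and ?R = "\<lambda>w. root_at M (map w [0..<m])"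
  let ?J = "?r ` fv \<phi>"
  let ?M = "\<lambda>I. PiM I (\<lambda>_. vmeas M)"
  let ?A = "{a \<in> space (?M (?I \<union> ?J)). sat M a (unroot m \<phi>)}"
  let ?S = "\<lambda>w. {y \<in> space (?M ?J). sat M (merge ?I ?J (w, y)) (unroot m \<phi>)}"
  have prob: "prob_space (vmeas M)"
    and ss: "sat_set M (unroot m \<phi>) \<in> sets (tuples M (unroot m \<phi>))"
    using assms(1) unroot_formulas by (auto simp: modeling_def)
  \<comment> \<open>Only constants occurring in \<open>\<phi>\<close> become free variables of
    \<open>unroot m \<phi>\<close>; reindexing by \<open>id\<close> pads the tuples to all
    \<open>m\<close> roots.\<close>
  have fv: "id ` fv (unroot m \<phi>) \<subseteq> ?I \<union> ?J"
    using assms(2) by (auto simp: fv_unroot formulas_def)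
  have fin: "finite ?I" "finite ?J" "?I \<inter> ?J = {}" by (auto simp: finite_fv)
  have A: "?A \<in> sets (?M (?I \<union> ?J))" "measure (?M (?I \<union> ?J)) ?A = stone (unroot m \<phi>) M"
    using sat_set_reindex[OF prob ss inj_on_id fv] by (simp_all only: comp_id)
  have sat: "sat M (merge ?I ?J (w, y)) (unroot m \<phi>) = sat (?R w) (y \<circ> ?r) \<phi>" for w y
  proof -
    have "sat M (merge ?I ?J (w, y)) (unroot m \<phi>) =
        sat (?R (merge ?I ?J (w, y))) (\<lambda>x. merge ?I ?J (w, y) (x + m)) \<phi>"
      by (rule sat_unroot[OF assms(2)])
    also have "\<dots> = sat (?R w) (\<lambda>x. merge ?I ?J (w, y) (x + m)) \<phi>"
      by (rule sat_roots_cong[OF assms(2)]) (simp add: merge_def)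
    also have "\<dots> = sat (?R w) (y \<circ> ?r) \<phi>"
      by (rule sat_cong) (simp add: merge_def)
    finally show ?thesis .
  qed
  note sec = PiM_Un_section[OF prob fin A(1)]
  show sets: "?sets w" if w: "w \<in> space (?M ?I)" for w
  proof -
    \<comment> \<open>The section is indexed by the shifted variables; \<open>?u\<close> carries its
      measurability back to tuples indexed by \<open>fv \<phi>\<close>.\<close>
    let ?u = "\<lambda>a. \<lambda>z\<in>?J. a (z - m)"
    have u: "?u \<in> measurable (tuples (?R w) \<phi>) (?M ?J)"
      unfolding tuples_def by (auto intro!: measurable_restrict measurable_component_singleton)
    have "sat (?R w) (?u a \<circ> ?r) \<phi> = sat (?R w) a \<phi>" for a
      by (rule sat_cong) simp
    then have "sat_set (?R w) \<phi> = ?u -` ?S w \<inter> space (tuples (?R w) \<phi>)"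
      using measurable_space[OF u] by (auto simp: sat_set_def sat)
    then show ?thesis
      using measurable_sets[OF u sec(1)[OF w]] by simp
  qed
  have eq: "measure (?M ?J) (?S w) = stone \<phi> (?R w)" if "w \<in> space (?M ?I)" for w
  proof -
    have "measure (PiM ?J (\<lambda>_. vmeas (?R w))) {b \<in> space (PiM ?J (\<lambda>_. vmeas (?R w))). sat (?R w) (b \<circ> ?r) \<phi>}
        = stone \<phi> (?R w)"
      by (rule sat_set_reindex(2)[OF _ sets[OF that]]) (auto simp: prob inj_on_def)
    then show ?thesis by (simp only: sat root_at_simps)
  qed
  have "?meas \<longleftrightarrow> (\<lambda>w. measure (?M ?J) (?S w)) \<in> borel_measurable (?M ?I)"
    by (rule measurable_cong) (simp only: eq)
  then show ?meas
    using sec(2) by (rule iffD2)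
  have "stone (unroot m \<phi>) M = (\<integral>w. measure (?M ?J) (?S w) \<partial>?M ?I)"
    unfolding A(2)[symmetric] by (rule sec(3))
  also have "\<dots> = (\<integral>w. stone \<phi> (?R w) \<partial>?M ?I)"
    by (rule Bochner_Integration.integral_cong[OF refl eq])
  finally show ?int .
qed

text \<open>Every section of a measurable set is measurable, so this holds for all choices of roots
  and not just for almost all.\<close>

lemma modeling_root_at:
  assumes "modeling 0 M" "w \<in> space (PiM {..<m} (\<lambda>_. vmeas M))"
  shows "modeling m (root_at M (map w [0..<m]))"
proof -
  have "w i \<in> verts M" if "i < m" for i
    using PiE_mem[OF assms(2)[unfolded space_PiM]] that by simp
  then have "set (map w [0..<m]) \<subseteq> verts M"
    by (simp add: image_subset_iff)
  moreover have "simple_graph (root_at M (map w [0..<m])) = simple_graph M"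
    by (simp only: simple_graph_def root_at_simps)
  moreover have "simple_graph M" "prob_space (vmeas M)"
    using assms(1) by (auto simp only: modeling_def)
  ultimately show ?thesis
    unfolding modeling_def root_at_simps
    by (intro conjI ballI rooted_stone(1)[OF assms(1) _ assms(2)]) simp_all
qed

lemma stone_bounds:
  assumes "modeling m G"
  shows "0 \<le> stone \<phi> G" "stone \<phi> G \<le> 1"
proof -
  interpret prob_space "tuples G \<phi>"
    unfolding tuples_def using assms by (intro prob_space_PiM) (simp add: modeling_def)
  show "0 \<le> stone \<phi> G" "stone \<phi> G \<le> 1" by (simp_all add: stone_def)
qed

section \<open>Polynomials in Stone pairings and their integrals over the roots\<close>

text \<open>The same polynomial in Stone pairings, read once over each vertex type.\<close>

inductive stone_poly :: "nat \<Rightarrow> ('a mgraph \<Rightarrow> real) \<Rightarrow> ('b mgraph \<Rightarrow> real) \<Rightarrow> bool" for m where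
  stone_poly_const: "stone_poly m (\<lambda>_. c) (\<lambda>_. c)"
| stone_poly_stone: "\<phi> \<in> formulas m \<Longrightarrow> stone_poly m (stone \<phi>) (stone \<phi>)"
| stone_poly_add: "stone_poly m f h \<Longrightarrow> stone_poly m f' h' \<Longrightarrow>
    stone_poly m (\<lambda>G. f G + f' G) (\<lambda>H. h H + h' H)"
| stone_poly_mult: "stone_poly m f h \<Longrightarrow> stone_poly m f' h' \<Longrightarrow>
    stone_poly m (\<lambda>G. f G * f' G) (\<lambda>H. h H * h' H)"

lemma stone_poly_diff:
  assumes "stone_poly m f h" "stone_poly m f' h'"
  shows "stone_poly m (\<lambda>G. f G - f' G) (\<lambda>H. h H - h' H)"
  using stone_poly_add[OF assms(1) stone_poly_mult[OF stone_poly_const[of m "-1"] assms(2)]] by simp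

lemma stone_poly_power: "stone_poly m f h \<Longrightarrow> stone_poly m (\<lambda>G. f G ^ k) (\<lambda>H. h H ^ k)"
  by (induction k) (auto intro: stone_poly.intros)

lemma stone_poly_sum:
  "(\<And>j. j < K \<Longrightarrow> stone_poly m (f j) (h j)) \<Longrightarrow>
    stone_poly m (\<lambda>G. \<Sum>j<(K::nat). f j G) (\<lambda>H. \<Sum>j<K. h j H)"
  by (induction K) (auto intro: stone_poly.intros)

text \<open>The list is data free of the vertex type, so one list can be evaluated on the graphs
  \<open>G n\<close> and on \<open>M\<close>.\<close>

definition lincomb :: "(real \<times> fm) list \<Rightarrow> 'a mgraph \<Rightarrow> real" where
  "lincomb xs G = (\<Sum>(c, \<phi>)\<leftarrow>xs. c * stone \<phi> G)"

definition lincomb_mult :: "(real \<times> fm) list \<Rightarrow> (real \<times> fm) list \<Rightarrow> (real \<times> fm) list" where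
  "lincomb_mult xs ys = concat (map (\<lambda>(c, \<phi>). map (\<lambda>(d, \<psi>). (c * d, dconj \<phi> \<psi>)) ys) xs)"

lemma lincomb_append: "lincomb (xs @ ys) G = lincomb xs G + lincomb ys G"
  by (simp add: lincomb_def)

lemma lincomb_mult:
  assumes "modeling m G" "snd ` set xs \<subseteq> formulas m" "snd ` set ys \<subseteq> formulas m"
  shows "lincomb (lincomb_mult xs ys) G = lincomb xs G * lincomb ys G"
  using assms(2)
proof (induction xs)
  case Nil
  then show ?case by (simp add: lincomb_mult_def lincomb_def)
next
  case (Cons p xs)
  obtain c \<phi> where p: "p = (c, \<phi>)" by (cases p)
  have "lincomb (map (\<lambda>(d, \<psi>). (c * d, dconj \<phi> \<psi>)) ys) G = c * stone \<phi> G * lincomb ys G"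
    using assms(3)
  proof (induction ys)
    case (Cons q ys)
    then show ?case
      using Cons.prems \<open>snd ` set (p # xs) \<subseteq> formulas m\<close> stone_dconj[OF assms(1), of \<phi> "snd q"]
      by (cases q) (simp add: lincomb_def p algebra_simps)
  qed (simp add: lincomb_def)
  then show ?case
    using Cons by (simp add: lincomb_mult_def lincomb_append p) (simp add: lincomb_def algebra_simps)
qed

lemma lincomb_mult_formulas:
  "snd ` set xs \<subseteq> formulas m \<Longrightarrow> snd ` set ys \<subseteq> formulas m \<Longrightarrow>
    snd ` set (lincomb_mult xs ys) \<subseteq> formulas m"
  by (fastforce simp: lincomb_mult_def intro: dconj_formulas)

text \<open>A valid sentence represents the constant 1, so constant polynomials also become linear
  combinations.\<close>

lemma stone_true:
  assumes "modeling m G"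
  shows "stone (Ex 0 (Equal (Var 0) (Var 0))) G = 1"
proof -
  have "verts G \<noteq> {}"
    using assms prob_space.not_empty[of "vmeas G"] by (auto simp: modeling_def)
  then show ?thesis by (subst stone_sentence) auto
qed

text \<open>Products are absorbed by \<open>dconj\<close>, so on modelings every polynomial in Stone
  pairings is linear in them. That the same list serves \<open>f\<close> and \<open>h\<close> is
  what later links the integrals over \<open>G n\<close> to the integral over
  \<open>M\<close>.\<close>

lemma stone_poly_lincomb:
  assumes "stone_poly m f h"
  shows "\<exists>xs. snd ` set xs \<subseteq> formulas m \<and> (\<forall>G. modeling m G \<longrightarrow> f G = lincomb xs G) \<and>
    (\<forall>H. modeling m H \<longrightarrow> h H = lincomb xs H)"
  using assms
proof induction
  case (stone_poly_const c)
  show ?case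
    by (intro exI[of _ "[(c, Ex 0 (Equal (Var 0) (Var 0)))]"])
      (simp add: lincomb_def formulas_def stone_true)
next
  case (stone_poly_stone \<phi>)
  then show ?case by (intro exI[of _ "[(1, \<phi>)]"]) (simp add: lincomb_def)
next
  case (stone_poly_add f h f' h')
  then obtain xs ys where "snd ` set xs \<subseteq> formulas m" "snd ` set ys \<subseteq> formulas m"
    "\<forall>G. modeling m G \<longrightarrow> f G = lincomb xs G" "\<forall>G. modeling m G \<longrightarrow> h G = lincomb xs G"
    "\<forall>G. modeling m G \<longrightarrow> f' G = lincomb ys G" "\<forall>G. modeling m G \<longrightarrow> h' G = lincomb ys G"
    by blast
  then show ?case by (intro exI[of _ "xs @ ys"]) (simp add: lincomb_append image_Un)
next
  case (stone_poly_mult f h f' h')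
  then obtain xs ys where *: "snd ` set xs \<subseteq> formulas m" "snd ` set ys \<subseteq> formulas m"
    "\<forall>G. modeling m G \<longrightarrow> f G = lincomb xs G" "\<forall>G. modeling m G \<longrightarrow> h G = lincomb xs G"
    "\<forall>G. modeling m G \<longrightarrow> f' G = lincomb ys G" "\<forall>G. modeling m G \<longrightarrow> h' G = lincomb ys G"
    by blast
  then show ?case
    using lincomb_mult_formulas[OF *(1,2)]
    by (intro exI[of _ "lincomb_mult xs ys"]) (simp add: lincomb_mult[OF _ *(1,2)])
qed

lemma integral_lincomb:
  assumes "modeling 0 M" "snd ` set xs \<subseteq> formulas m"
  defines "W \<equiv> PiM {..<m} (\<lambda>_. vmeas M)"
  shows "integrable W (\<lambda>w. lincomb xs (root_at M (map w [0..<m])))"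
    and "(\<integral>w. lincomb xs (root_at M (map w [0..<m])) \<partial>W) = (\<Sum>(c, \<phi>)\<leftarrow>xs. c * stone (unroot m \<phi>) M)"
proof -
  let ?R = "\<lambda>w. root_at M (map w [0..<m])"
  interpret W: prob_space W
    unfolding W_def using assms(1) by (intro prob_space_PiM) (simp add: modeling_def)
  have int: "integrable W (\<lambda>w. stone \<phi> (?R w))" if "\<phi> \<in> formulas m" for \<phi>
    using rooted_stone(2)[OF assms(1) that] stone_bounds[OF modeling_root_at[OF assms(1)], of _ m \<phi>]
    by (intro W.integrable_const_bound[where B = 1]) (auto simp: W_def)
  have "integrable W (\<lambda>w. lincomb xs (?R w)) \<and>
    (\<integral>w. lincomb xs (?R w) \<partial>W) = (\<Sum>(c, \<phi>)\<leftarrow>xs. c * stone (unroot m \<phi>) M)"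
    using assms(2)
  proof (induction xs)
    case (Cons p xs)
    obtain c \<phi> where p: "p = (c, \<phi>)" by (cases p)
    have \<phi>: "\<phi> \<in> formulas m" using Cons.prems by (simp add: p)
    have step: "lincomb (p # xs) (?R w) = c * stone \<phi> (?R w) + lincomb xs (?R w)" for w
      by (simp add: lincomb_def p)
    show ?case
      unfolding step using Cons int[OF \<phi>] rooted_stone(3)[OF assms(1) \<phi>]
      by (simp add: p W_def)
  qed (simp add: lincomb_def)
  then show "integrable W (\<lambda>w. lincomb xs (?R w))"
    "(\<integral>w. lincomb xs (?R w) \<partial>W) = (\<Sum>(c, \<phi>)\<leftarrow>xs. c * stone (unroot m \<phi>) M)" by auto
qed

lemma stone_poly_integrable:
  assumes "stone_poly m f h"
  shows "modeling 0 G \<Longrightarrow> integrable (PiM {..<m} (\<lambda>_. vmeas G)) (\<lambda>w. f (root_at G (map w [0..<m])))"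
    and "modeling 0 H \<Longrightarrow> integrable (PiM {..<m} (\<lambda>_. vmeas H)) (\<lambda>w. h (root_at H (map w [0..<m])))"
proof -
  obtain xs where xs: "snd ` set xs \<subseteq> formulas m" "\<forall>G. modeling m G \<longrightarrow> f G = lincomb xs G"
    "\<forall>H. modeling m H \<longrightarrow> h H = lincomb xs H"
    using stone_poly_lincomb[OF assms] by blast
  show "integrable (PiM {..<m} (\<lambda>_. vmeas G)) (\<lambda>w. f (root_at G (map w [0..<m])))" if "modeling 0 G"
    by (rule Bochner_Integration.integrable_cong[THEN iffD1, OF refl _ integral_lincomb(1)[OF that xs(1)]])
      (simp add: xs(2) modeling_root_at[OF that])
  show "integrable (PiM {..<m} (\<lambda>_. vmeas H)) (\<lambda>w. h (root_at H (map w [0..<m])))" if "modeling 0 H"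
    by (rule Bochner_Integration.integrable_cong[THEN iffD1, OF refl _ integral_lincomb(1)[OF that xs(1)]])
      (simp add: xs(3) modeling_root_at[OF that])
qed

text \<open>Both integrals are the same linear combination of the unrooted pairings
  \<open>stone (unroot m \<phi>)\<close>, and \<open>fo_limit 0\<close> applies to each
  term.\<close>

lemma stone_poly_integral_tendsto:
  assumes "stone_poly m f h" "\<And>n. modeling 0 (G n)" "modeling 0 M" "fo_limit 0 G M"
  shows "(\<lambda>n. \<integral>w. f (root_at (G n) (map w [0..<m])) \<partial>PiM {..<m} (\<lambda>_. vmeas (G n)))
    \<longlonglongrightarrow> (\<integral>w. h (root_at M (map w [0..<m])) \<partial>PiM {..<m} (\<lambda>_. vmeas M))"
proof -
  obtain xs where xs: "snd ` set xs \<subseteq> formulas m" "\<forall>G. modeling m G \<longrightarrow> f G = lincomb xs G"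
    "\<forall>H. modeling m H \<longrightarrow> h H = lincomb xs H"
    using stone_poly_lincomb[OF assms(1)] by blast
  have "(\<integral>w. f (root_at (G n) (map w [0..<m])) \<partial>PiM {..<m} (\<lambda>_. vmeas (G n))) =
      (\<Sum>(c, \<phi>)\<leftarrow>xs. c * stone (unroot m \<phi>) (G n))" for n
    unfolding integral_lincomb(2)[OF assms(2) xs(1), symmetric]
    by (rule Bochner_Integration.integral_cong[OF refl]) (simp add: xs(2) modeling_root_at[OF assms(2)])
  moreover have "(\<integral>w. h (root_at M (map w [0..<m])) \<partial>PiM {..<m} (\<lambda>_. vmeas M)) =
      (\<Sum>(c, \<phi>)\<leftarrow>xs. c * stone (unroot m \<phi>) M)"
    unfolding integral_lincomb(2)[OF assms(3) xs(1), symmetric]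
    by (rule Bochner_Integration.integral_cong[OF refl]) (simp add: xs(3) modeling_root_at[OF assms(3)])
  moreover have "(\<lambda>n. \<Sum>(c, \<phi>)\<leftarrow>xs. c * stone (unroot m \<phi>) (G n)) \<longlonglongrightarrow>
      (\<Sum>(c, \<phi>)\<leftarrow>xs. c * stone (unroot m \<phi>) M)"
    using assms(4) unroot_formulas[of m _ 0] by (induction xs) (auto intro!: tendsto_intros simp: fo_limit_def)
  ultimately show ?thesis by (simp only:)
qed

section \<open>Large values from moments, and diagonal selection\<close>

text \<open>For large \<open>k\<close> the \<open>k\<close>-th moment of a nonnegative function is governed by its essential
  supremum, so no uniform approximation by polynomials is needed.\<close>

lemma eventually_exceeds_if_moments_tendsto:
  fixes X :: "nat \<Rightarrow> 'a \<Rightarrow> real" and Y :: "'b \<Rightarrow> real"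
  assumes N: "\<And>n. prob_space (N n)" and L: "prob_space L"
    and X0: "\<And>n v. v \<in> space (N n) \<Longrightarrow> 0 \<le> X n v" and Y0: "\<And>w. w \<in> space L \<Longrightarrow> 0 \<le> Y w"
    and intX: "\<And>n k. integrable (N n) (\<lambda>v. X n v ^ k)" and intY: "\<And>k. integrable L (\<lambda>w. Y w ^ k)"
    and lim: "\<And>k. (\<lambda>n. \<integral>v. X n v ^ k \<partial>N n) \<longlonglongrightarrow> (\<integral>w. Y w ^ k \<partial>L)"
    and pos: "measure L {w \<in> space L. a < Y w} > 0" and "b < a"
  shows "eventually (\<lambda>n. \<exists>v\<in>space (N n). b < X n v) sequentially"
\<comment> \<open>For negative \<open>b\<close> any point works by nonnegativity; otherwise
  \<open>a > 0\<close> and the ratio \<open>b / a\<close> lies in \<open>[0, 1)\<close>.\<close>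
proof (cases "b < 0")
  case True
  have "\<exists>v\<in>space (N n). b < X n v" for n
    using prob_space.not_empty[OF N[of n]] X0 True by force
  then show ?thesis by simp
next
  case False
  interpret L: prob_space L by fact
  let ?p = "measure L {w \<in> space L. a < Y w}"
  \<comment> \<open>The exponent \<open>k\<close> is chosen so large that \<open>b ^ k\<close> lies
    below \<open>?p * a ^ k\<close>, a lower bound of the \<open>k\<close>-th moment of
    \<open>Y\<close>. A function bounded by \<open>b\<close> everywhere cannot reach such a
    moment.\<close>
  have a: "0 < a" "0 \<le> b / a" "b / a < 1" using False \<open>b < a\<close> by auto
  from order_tendstoD(2)[OF LIMSEQ_realpow_zero[OF a(2,3)] pos]
  obtain k where k: "(b / a) ^ k < ?p" by (auto simp: eventually_sequentially)
  have Ym: "Y \<in> borel_measurable L" using intY[of 1] by auto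
  have "b ^ k < ?p * a ^ k"
    using k a(1) by (simp add: power_divide divide_less_eq)
  also have "?p * a ^ k = (\<integral>w. indicator {w \<in> space L. a < Y w} w * a ^ k \<partial>L)"
    by (subst Bochner_Integration.integral_mult_left_zero, subst Bochner_Integration.integral_indicator)
      (intro arg_cong2[where f = "(*)"] arg_cong[where f = "measure _"] refl, blast)
  also have "\<dots> \<le> (\<integral>w. Y w ^ k \<partial>L)"
  proof (rule integral_mono)
    show "integrable L (\<lambda>w. indicator {w \<in> space L. a < Y w} w * a ^ k)"
      using Ym by (intro integrable_mult_left integrable_real_indicator) (auto simp: L.emeasure_eq_measure)
    show "indicator {w \<in> space L. a < Y w} w * a ^ k \<le> Y w ^ k" if "w \<in> space L" for w
      using Y0[OF that] a(1) by (auto simp: indicator_def intro: power_mono)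
  qed (rule intY)
  finally have "eventually (\<lambda>n. b ^ k < (\<integral>v. X n v ^ k \<partial>N n)) sequentially"
    by (rule order_tendstoD(1)[OF lim])
  then show ?thesis
  proof eventually_elim
    case (elim n)
    interpret N: prob_space "N n" by (rule N)
    show ?case
    proof (rule ccontr)
      assume "\<not> ?thesis"
      then have "(\<integral>v. X n v ^ k \<partial>N n) \<le> (\<integral>v. b ^ k \<partial>N n)"
        using X0 by (intro integral_mono intX) (auto intro!: power_mono simp: not_less)
      with elim show False by (simp add: N.prob_space)
    qed
  qed
qed

text \<open>Take for \<open>k n\<close> the largest level \<open>K \<le> n\<close> that has a
  witness at \<open>n\<close>. The bound by \<open>n\<close> makes the maximum exist, level 0 keeps
  the set nonempty, and each level is eventually available, so \<open>k\<close> tends to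
  infinity.\<close>

lemma diagonal_choice:
  fixes P :: "nat \<Rightarrow> nat \<Rightarrow> 'a \<Rightarrow> bool"
  assumes ev: "\<And>K. eventually (\<lambda>n. \<exists>v. P K n v) sequentially" and P0: "\<And>n. \<exists>v. P 0 n v"
  obtains v k where "\<And>n. P (k n) n (v n)" "filterlim k at_top sequentially"
proof -
  define k where "k n = Max {K. K \<le> n \<and> (\<exists>v. P K n v)}" for n
  have fin: "finite {K. K \<le> n \<and> (\<exists>v. P K n v)}" for n by (rule finite_subset[of _ "{..n}"]) auto
  have "k n \<in> {K. K \<le> n \<and> (\<exists>v. P K n v)}" for n
    unfolding k_def using P0[of n] by (intro Max_in fin) auto
  then have "\<exists>v. \<forall>n. P (k n) n (v n)" by (intro choice) auto
  moreover have "eventually (\<lambda>n. K \<le> k n) sequentially" for K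
    using ev[of K] eventually_ge_at_top[of K]
    by eventually_elim (auto simp: k_def intro!: Max_ge fin)
  ultimately show ?thesis using that unfolding filterlim_at_top by blast
qed

section \<open>Balls around rational centres\<close>

text \<open>Rational centres of finite length leave only countably many balls, and squaring keeps
  the distance a polynomial in Stone pairings.\<close>

definition sqdist :: "(nat \<Rightarrow> fm) \<Rightarrow> rat list \<Rightarrow> 'a mgraph \<Rightarrow> real" where
  "sqdist e qs G = (\<Sum>j<length qs. (stone (e j) G - of_rat (qs ! j))\<^sup>2)"

lemma sqdist_bounds:
  assumes "modeling m G"
  shows "0 \<le> sqdist e qs G" "sqdist e qs G \<le> (\<Sum>j<length qs. (1 + \<bar>of_rat (qs ! j)\<bar>)\<^sup>2)"
proof -
  show "0 \<le> sqdist e qs G" by (auto simp: sqdist_def intro: sum_nonneg)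
  have "\<bar>stone (e j) G - of_rat (qs ! j)\<bar> \<le> \<bar>1 + \<bar>of_rat (qs ! j)\<bar>\<bar>" for j
    using stone_bounds[OF assms, of "e j"] by linarith
  then show "sqdist e qs G \<le> (\<Sum>j<length qs. (1 + \<bar>of_rat (qs ! j)\<bar>)\<^sup>2)"
    unfolding sqdist_def by (intro sum_mono) (simp only: abs_le_square_iff[symmetric])
qed

lemma stone_poly_sqdist:
  assumes "range e \<subseteq> formulas m"
  shows "stone_poly m (sqdist e qs) (sqdist e qs)"
  unfolding sqdist_def[abs_def]
  using assms by (intro stone_poly_sum stone_poly_power stone_poly_diff stone_poly_const stone_poly_stone) auto

lemma sqdist_component:
  assumes "sqdist e qs G < d" "j < length qs"
  shows "(stone (e j) G - of_rat (qs ! j))\<^sup>2 < d"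
proof -
  have "(stone (e j) G - of_rat (qs ! j))\<^sup>2 \<le> sqdist e qs G"
    unfolding sqdist_def using assms(2) by (intro member_le_sum) auto
  with assms(1) show ?thesis by simp
qed

lemma sqdist_dense:
  assumes "d > 0"
  obtains qs where "length qs = K" "sqdist e qs G < d"
proof -
  \<comment> \<open>With \<open>K + 1\<close> in the denominator the \<open>K\<close> squared errors
    sum to strictly less than \<open>d\<close>, and \<open>K = 0\<close> needs no special
    case.\<close>
  have "\<exists>q. \<bar>stone (e j) G - of_rat q\<bar> < sqrt (d / (real K + 1))" for j
    using of_rat_dense[of "stone (e j) G - sqrt (d / (real K + 1))" "stone (e j) G"] assms
    by (auto simp: abs_less_iff) (smt (verit))
  then obtain q where q: "\<bar>stone (e j) G - of_rat (q j)\<bar> < sqrt (d / (real K + 1))" for j by metis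
  have "(stone (e j) G - of_rat (q j))\<^sup>2 \<le> d / (real K + 1)" for j
    using power_mono[OF less_imp_le[OF q[of j]], of 2] assms by simp
  then have "sqdist e (map q [0..<K]) G \<le> real K * (d / (real K + 1))"
    unfolding sqdist_def by (intro order_trans[OF sum_bounded_above[where K = "d / (real K + 1)"]]) auto
  also have "\<dots> < d" using assms by (simp add: field_simps)
  finally show ?thesis using that[of "map q [0..<K]"] by simp
qed

text \<open>There are countably many pairs \<open>qs\<close>, \<open>k\<close>, so the balls of
  measure zero together form a null set; every \<open>w\<close> outside it qualifies.\<close>

lemma AE_sqdist_support:
  assumes "modeling 0 M" "range e \<subseteq> formulas m"
  defines "W \<equiv> PiM {..<m} (\<lambda>_. vmeas M)"
  defines "B \<equiv> \<lambda>qs k. {w \<in> space W. sqdist e qs (root_at M (map w [0..<m])) < 1 / real (Suc k)}"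
  shows "AE w in W. \<forall>qs k. w \<in> B qs k \<longrightarrow> measure W (B qs k) > 0"
proof -
  interpret W: prob_space W
    unfolding W_def using assms(1) by (intro prob_space_PiM) (simp add: modeling_def)
  have "AE w in W. w \<in> B qs k \<longrightarrow> measure W (B qs k) > 0" for qs k
  proof (cases "measure W (B qs k) = 0")
    case True
    have "(\<lambda>w. sqdist e qs (root_at M (map w [0..<m]))) \<in> borel_measurable W"
      using stone_poly_integrable(2)[OF stone_poly_sqdist[OF assms(2)] assms(1)] by (simp add: W_def)
    then have "B qs k \<in> sets W"
      unfolding B_def by measurable
    with True have "B qs k \<in> null_sets W"
      by (simp add: null_setsI W.emeasure_eq_measure)
    then show ?thesis
      by (rule AE_I') auto
  next
    case False
    then show ?thesis by (simp add: less_le)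
  qed
  then show ?thesis by (simp add: AE_all_countable)
qed

text \<open>A ball around a rational centre near \<open>w\<close> has positive measure by
  \<open>supp\<close>. The moment comparison then gives roots in \<open>G n\<close> close to the
  same centre, and the triangle inequality finishes.\<close>

lemma eventually_roots_near:
  fixes G :: "nat \<Rightarrow> 'a mgraph" and M :: "'b mgraph"
  assumes G: "\<And>n. modeling 0 (G n)" and M: "modeling 0 M" and lim: "fo_limit 0 G M"
    and e: "range e \<subseteq> formulas m" and "\<epsilon> > 0"
  defines "W \<equiv> PiM {..<m} (\<lambda>_. vmeas M)"
  assumes w: "w \<in> space W"
    and supp: "\<And>qs k. sqdist e qs (root_at M (map w [0..<m])) < 1 / real (Suc k) \<Longrightarrow>
      measure W {w \<in> space W. sqdist e qs (root_at M (map w [0..<m])) < 1 / real (Suc k)} > 0"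
  shows "eventually (\<lambda>n. \<exists>v\<in>space (PiM {..<m} (\<lambda>_. vmeas (G n))). \<forall>j<K.
    \<bar>stone (e j) (root_at (G n) (map v [0..<m])) - stone (e j) (root_at M (map w [0..<m]))\<bar> < \<epsilon>) sequentially"
proof -
  let ?R = "\<lambda>H u. root_at H (map u [0..<m])"
  let ?V = "\<lambda>n. PiM {..<m} (\<lambda>_. vmeas (G n))"
  \<comment> \<open>The moment argument loses a strict margin, here from \<open>d\<close> to
    \<open>2 * d\<close>; the factor 8 still puts \<open>2 * d\<close> below the square of
    \<open>\<epsilon> / 2\<close>.\<close>
  obtain k where k: "1 / real (Suc k) < \<epsilon>\<^sup>2 / 8"
    using nat_approx_posE[of "\<epsilon>\<^sup>2 / 8"] \<open>\<epsilon> > 0\<close> by auto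
  define d where "d = 1 / real (Suc k)"
  have d: "d > 0" "2 * d < (\<epsilon> / 2)\<^sup>2" using k by (simp_all add: d_def power_divide)
  obtain qs where qs: "length qs = K" "sqdist e qs (?R M w) < d"
    using sqdist_dense[OF d(1)] by metis
  \<comment> \<open>This is the bound of \<open>sqdist_bounds\<close>; it makes
    \<open>c - sqdist\<close> nonnegative on all modelings, as the moment argument requires.\<close>
  define c where "c = (\<Sum>j<length qs. (1 + \<bar>real_of_rat (qs ! j)\<bar>)\<^sup>2)"
  have poly: "stone_poly m (\<lambda>H. (c - sqdist e qs H) ^ i) (\<lambda>H. (c - sqdist e qs H) ^ i)" for i
    by (intro stone_poly_power stone_poly_diff stone_poly_const stone_poly_sqdist e)
  have "eventually (\<lambda>n. \<exists>v\<in>space (?V n). c - 2 * d < c - sqdist e qs (?R (G n) v)) sequentially"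
  proof (rule eventually_exceeds_if_moments_tendsto[where a = "c - d" and L = W and Y = "\<lambda>w. c - sqdist e qs (?R M w)"])
    show "prob_space (?V n)" for n using G[of n] by (intro prob_space_PiM) (simp add: modeling_def)
    show "prob_space W" unfolding W_def using M by (intro prob_space_PiM) (simp add: modeling_def)
    show "0 \<le> c - sqdist e qs (?R (G n) v)" if "v \<in> space (?V n)" for n v
      using sqdist_bounds(2)[OF modeling_root_at[OF G that], of e qs] by (simp add: c_def)
    show "0 \<le> c - sqdist e qs (?R M w)" if "w \<in> space W" for w
      using sqdist_bounds(2)[OF modeling_root_at[OF M that[unfolded W_def]], of e qs] by (simp add: c_def)
    show "integrable (?V n) (\<lambda>v. (c - sqdist e qs (?R (G n) v)) ^ i)" for n i
      by (rule stone_poly_integrable(1)[OF poly G])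
    show "integrable W (\<lambda>w. (c - sqdist e qs (?R M w)) ^ i)" for i
      unfolding W_def by (rule stone_poly_integrable(2)[OF poly M])
    show "(\<lambda>n. \<integral>v. (c - sqdist e qs (?R (G n) v)) ^ i \<partial>?V n) \<longlonglongrightarrow> (\<integral>w. (c - sqdist e qs (?R M w)) ^ i \<partial>W)" for i
      unfolding W_def by (rule stone_poly_integral_tendsto[OF poly G M lim])
    show "measure W {w \<in> space W. c - d < c - sqdist e qs (?R M w)} > 0"
      using supp[of qs k] qs(2) by (simp add: d_def)
    show "c - 2 * d < c - d" using d(1) by simp
  qed
  then show ?thesis
  proof eventually_elim
    case (elim n)
    then obtain v where v: "v \<in> space (?V n)" "sqdist e qs (?R (G n) v) < 2 * d" by auto
    have "\<bar>stone (e j) (?R (G n) v) - stone (e j) (?R M w)\<bar> < \<epsilon>" if "j < K" for j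
    proof -
      have "\<bar>stone (e j) (?R (G n) v) - real_of_rat (qs ! j)\<bar> < \<epsilon> / 2"
        using sqdist_component[OF v(2), of j] that qs(1) d(2) \<open>\<epsilon> > 0\<close>
        by (intro power2_less_imp_less[of _ "\<epsilon> / 2"]) auto
      moreover have "\<bar>stone (e j) (?R M w) - real_of_rat (qs ! j)\<bar> < \<epsilon> / 2"
        using sqdist_component[OF qs(2), of j] that qs(1) d \<open>\<epsilon> > 0\<close>
        by (intro power2_less_imp_less[of _ "\<epsilon> / 2"]) auto
      ultimately show ?thesis by linarith
    qed
    with v(1) show ?case by blast
  qed
qed

theorem theorem6:
  fixes G :: "nat \<Rightarrow> 'a mgraph" and M :: "'b mgraph" and m :: nat
  assumes "\<And>n. finite_graph (G n)"
    and "fo_convergent 0 G"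
    and "modeling 0 M"
    and "fo_limit 0 G M"
    and "m > 0"
  shows "AE w in PiM {..<m} (\<lambda>_. vmeas M).
           modeling m (root_at M (map w [0..<m])) \<and>
           (\<exists>v :: nat \<Rightarrow> 'a list.
              (\<forall>n. length (v n) = m \<and> set (v n) \<subseteq> verts (G n)) \<and>
              fo_limit m (\<lambda>n. root_at (G n) (v n)) (root_at M (map w [0..<m])))"
proof -
  let ?R = "\<lambda>H u. root_at H (map u [0..<m])"
  let ?W = "PiM {..<m} (\<lambda>_. vmeas M)"
  let ?V = "\<lambda>n. PiM {..<m} (\<lambda>_. vmeas (G n))"
  define e where "e = from_nat_into (formulas m)"
  have "Equal (Var 0) (Var 0) \<in> formulas m" by (simp add: formulas_def)
  then have e: "range e = formulas m"
    unfolding e_def by (intro range_from_nat_into) auto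
  have G: "modeling 0 (G n)" for n by (rule modeling_finite_graph[OF assms(1)])
  have "AE w in ?W. w \<in> space ?W" by (rule AE_space)
  with AE_sqdist_support[OF assms(3) equalityD1[OF e]] show ?thesis
  proof eventually_elim
    case (elim w)
    \<comment> \<open>Level \<open>K\<close> controls the first \<open>K\<close> formulas with
      tolerance \<open>1 / (K + 1)\<close>; level 0 only asks for a tuple of vertices and so is
      always attainable.\<close>
    define P where "P K n v \<longleftrightarrow> v \<in> space (?V n) \<and>
      (\<forall>j<K. \<bar>stone (e j) (?R (G n) v) - stone (e j) (?R M w)\<bar> < 1 / real (Suc K))" for K n v
    have ev: "eventually (\<lambda>n. \<exists>v. P K n v) sequentially" for K
      using eventually_roots_near[OF G assms(3,4) equalityD1[OF e], of "1 / real (Suc K)" w K] elim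
      unfolding P_def by (simp add: Bex_def)
    have P0: "\<exists>v. P 0 n v" for n
    proof -
      have "prob_space (?V n)" using G[of n] by (intro prob_space_PiM) (simp add: modeling_def)
      from prob_space.not_empty[OF this] show ?thesis unfolding P_def by blast
    qed
    obtain v k where v: "\<And>n. P (k n) n (v n)" and k: "filterlim k at_top sequentially"
      using diagonal_choice[of P, OF ev P0] by blast
    have space: "v n \<in> space (?V n)" for n using v[of n] by (simp add: P_def)
    have "(\<lambda>n. stone \<phi> (?R (G n) (v n))) \<longlonglongrightarrow> stone \<phi> (?R M w)" if "\<phi> \<in> formulas m" for \<phi>
    proof -
      have "\<phi> \<in> range e" using that by (simp only: e)
      then obtain j where j: "\<phi> = e j" by (rule rangeE)
      have "(\<lambda>n. 1 / real (Suc (k n))) \<longlonglongrightarrow> 0"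
        by (rule filterlim_compose[OF lim_1_over_n[THEN LIMSEQ_Suc] k])
      moreover have "eventually (\<lambda>n. norm (stone \<phi> (?R (G n) (v n)) - stone \<phi> (?R M w)) \<le> 1 / real (Suc (k n))) sequentially"
        \<comment> \<open>The formula \<open>e j\<close> is controlled from level
          \<open>Suc j\<close> on, since level \<open>K\<close> covers only indices below
          \<open>K\<close>.\<close>
        using filterlim_at_top[THEN iffD1, OF k, rule_format, of "Suc j"]
      proof eventually_elim
        case (elim n)
        then have "j < k n" by simp
        then have "\<bar>stone (e j) (?R (G n) (v n)) - stone (e j) (?R M w)\<bar> < 1 / real (Suc (k n))"
          using v[of n] unfolding P_def by blast
        then show ?case unfolding j real_norm_def by (rule less_imp_le)
      qed
      ultimately have "(\<lambda>n. stone \<phi> (?R (G n) (v n)) - stone \<phi> (?R M w)) \<longlonglongrightarrow> 0"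
        by (rule Lim_null_comparison[rotated])
      then show ?thesis by (rule LIM_zero_cancel)
    qed
    then have "fo_limit m (\<lambda>n. ?R (G n) (v n)) (?R M w)"
      unfolding fo_limit_def by blast
    moreover have "length (map (v n) [0..<m]) = m \<and> set (map (v n) [0..<m]) \<subseteq> verts (G n)" for n
      using modeling_root_at[OF G space[of n]] unfolding modeling_def root_at_simps by blast
    moreover have "modeling m (?R M w)"
      using elim(2) by (rule modeling_root_at[OF assms(3)])
    ultimately show ?case
      by (intro conjI exI[of _ "\<lambda>n. map (v n) [0..<m]"] allI) (simp_all only:)
  qed
qed

end
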